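(* Let $U=V_FV_B^{*}:\mathcal H_B\to\mathcal H_F$ be the unitary from the Bose-Fock space to the Fermi-Fock space defined in the context, and identify $b_n$ with $\pi_B(b_n)$ and $a_n$ with $\pi_F(a_n)$ for $n\ge 1$. For $n\geq 0$ and $m\geq 1$ put $$A_{n,m}\equiv a_{n+1}^{*}a_{n+2}^{*}\cdots a_{n+m}^{*}.$$ (i) $U\Omega_B=\Omega_F$, and for all $m\ge 1$, all integers $1\leq n_1<\cdots<n_m$ and all integers $k_1,\ldots,k_m\geq 1$, $$U\,(b_{n_1}^{*})^{k_1}\cdots(b_{n_m}^{*})^{k_m}\Omega_B = C\cdot A_{n_1-1,\,k_1}\,A_{n_2+k_1-1,\,k_2}\cdots A_{n_m+k_1+\cdots+k_{m-1}-1,\,k_m}\,\Omega_F ,$$ where $C\equiv\sqrt{k_1!\cdots k_m!}$. (ii) Let $\mathcal H_{B,n}$ and $\mathcal H_{F,n}$ denote the subspaces of all $n$-particle states of $\mathcal H_B$ and $\mathcal H_F$, respectively, for $n\geq 0$. Then $U\mathcal H_{B,n}=\mathcal H_{F,n}$ for all $n\geq 0$.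
   Context: $\mathbf N=\{1,2,3,\ldots\}$. $\mathcal O_2$ is the Cuntz algebra with canonical generators $t_1,t_2$: $t_i^*t_j=\delta_{ij}I$, $t_1t_1^*+t_2t_2^*=I$. $\mathcal B$ is the $*$-algebra of bosons, generated by $\{b_n:n\in\mathbf N\}$ with $b_nb_m^*-b_m^*b_n=\delta_{nm}I$, $b_nb_m-b_mb_n=b_n^*b_m^*-b_m^*b_n^*=0$. $\mathcal A$ is the $*$-algebra of fermions, generated by $\{a_n:n\in\mathbf N\}$ with $a_na_m^*+a_m^*a_n=\delta_{nm}I$, $a_na_m+a_ma_n=a_n^*a_m^*+a_m^*a_n^*=0$. Fock representations: $(\mathcal H_B,\pi_B)$ is the Bose-Fock representation, i.e. a $*$-representation of $\mathcal B$ by operators on the dense subspace $\pi_B(\mathcal B)\Omega_B$ of the Hilbert space $\mathcal H_B$, with unit vector (vacuum) $\Omega_B$ satisfying $\pi_B(b_n)\Omega_B=0$ for all $n$. $(\mathcal H_F,\pi_F)$ is the Fermi-Fock representation, i.e. a $*$-representation of $\mathcal A$ on the Hilbert space $\mathcal H_F$ with unit vector (vacuum) $\Omega_F$ such that $\pi_F(\mathcal A)\Omega_F$ is dense and $\pi_F(a_n)\Omega_F=0$ for all $n$. For $n\ge1$ the $n$-particle subspace $\mathcal H_{B,n}$ (resp. $\mathcal H_{F,n}$) is the closed linear span of all products of $n$ creation operators $b_j^*$ (resp. $a_j^*$) applied to the vacuum; $\mathcal H_{B,0}=\mathbf C\Omega_B$, $\mathcal H_{F,0}=\mathbf C\Omega_F$.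 Definition of $U$: Let $(\mathcal H,\pi)$ be a unital $*$-representation of $\mathcal O_2$ with a cyclic unit vector $\Omega$ satisfying $\pi(t_1)\Omega=\Omega$ (it exists and is unique up to unitary equivalence); write $t_i$ for $\pi(t_i)$. Let $\mathcal D$ be the linear span of $\{t_{i_1}\cdots t_{i_m}\Omega: i_1,\ldots,i_m\in\{1,2\},\ m\ge1\}$, a dense subspace of $\mathcal H$. Put $s_m\equiv t_2^{m-1}t_1$ for $m\geq1$ ($t_2^0=I$). A representation $\pi_{RBS}$ of $\mathcal B$ on $\mathcal D$ is given by $$b_1=\sum_{m=1}^\infty\sqrt m\,s_ms_{m+1}^*,\qquad b_n=\rho(b_{n-1})\ (n\ge2),\qquad \rho(x)=\sum_{m=1}^\infty s_mxs_m^*,$$ (together with the adjoints; the sums are finite on each vector of $\mathcal D$). A representation $\pi_{RFS}$ of $\mathcal A$ on $\mathcal H$ is given by $$a_1=t_1t_2^*,\qquad a_n=\zeta(a_{n-1})\ (n\ge2),\qquad \zeta(y)=t_1yt_1^*-t_2yt_2^*.$$ It is known that there are unitaries $V_B:\mathcal H\to\mathcal H_B$ and $V_F:\mathcal H\to\mathcal H_F$ with $V_B\pi_{RBS}(\cdot)V_B^*=\pi_B$, $V_F\pi_{RFS}(\cdot)V_F^*=\pi_F$ (with $V_B\mathcal D=\pi_B(\mathcal B)\Omega_B$), $V_B\Omega=\Omega_B$ and $V_F\Omega=\Omega_F$; these properties determine them. Define $U\equiv V_FV_B^*$. *)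

theory Defs
  imports "HOL-Analysis.Analysis"
begin

text \<open>The inner product is linear in the second argument.\<close>

class complex_hilbert = banach +
  fixes scaleC :: "complex \<Rightarrow> 'a \<Rightarrow> 'a"  (infixr "*\<^sub>C" 75)
    and cinner :: "'a \<Rightarrow> 'a \<Rightarrow> complex"
  assumes scaleC_add_right: "c *\<^sub>C (x + y) = c *\<^sub>C x + c *\<^sub>C y"
    and scaleC_add_left: "(c + d) *\<^sub>C x = c *\<^sub>C x + d *\<^sub>C x"
    and scaleC_scaleC: "c *\<^sub>C d *\<^sub>C x = (c * d) *\<^sub>C x"
    and scaleR_scaleC: "scaleR r x = complex_of_real r *\<^sub>C x"
    and cinner_commute: "cinner x y = cnj (cinner y x)"
    and cinner_add_right: "cinner x (y + z) = cinner x y + cinner x z"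
    and cinner_scaleC_right: "cinner x (c *\<^sub>C y) = c * cinner x y"
    and cinner_self: "cinner x x = complex_of_real ((norm x)\<^sup>2)"

global_interpretation cvec: vector_space "scaleC :: complex \<Rightarrow> 'a \<Rightarrow> 'a::complex_hilbert"
proof
  show "1 *\<^sub>C x = x" for x :: 'a
    using scaleR_scaleC[of 1 x] by simp
qed (simp_all add: scaleC_add_right scaleC_add_left scaleC_scaleC)

definition clinear_on :: "'a::complex_hilbert set \<Rightarrow> ('a \<Rightarrow> 'b::complex_hilbert) \<Rightarrow> bool" where
  "clinear_on D A \<longleftrightarrow>
     (\<forall>x\<in>D. \<forall>y\<in>D. A (x + y) = A x + A y) \<and> (\<forall>c. \<forall>x\<in>D. A (c *\<^sub>C x) = c *\<^sub>C A x)"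

text \<open>
  Operators are total functions whose values matter only on their domain \<open>D\<close>.
  The adjoint on \<open>D\<close> is the formal adjoint with values in \<open>D\<close>; it is unique when \<open>D\<close>
  is dense. For \<open>D = UNIV\<close> this is the Hilbert space adjoint.
\<close>

definition adj_on :: "'a::complex_hilbert set \<Rightarrow> ('a \<Rightarrow> 'b::complex_hilbert) \<Rightarrow> 'b \<Rightarrow> 'a" where
  "adj_on D A y = (THE z. z \<in> D \<and> (\<forall>x\<in>D. cinner z x = cinner y (A x)))"

abbreviation adj :: "('a::complex_hilbert \<Rightarrow> 'b::complex_hilbert) \<Rightarrow> 'b \<Rightarrow> 'a" where
  "adj \<equiv> adj_on UNIV"

definition unitary :: "('a::complex_hilbert \<Rightarrow> 'b::complex_hilbert) \<Rightarrow> bool" where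
  "unitary V \<longleftrightarrow> clinear_on UNIV V \<and> surj V \<and> (\<forall>x y. cinner (V x) (V y) = cinner x y)"

text \<open>
  A unital *-representation of the *-algebra with generators \<open>g n\<close> (\<open>n \<in> I\<close>) and given
  relations is rendered by the operators representing the generators: they act on a common dense
  invariant domain \<open>D\<close>, have adjoints on \<open>D\<close>, and satisfy the relations on \<open>D\<close>. For
  \<open>D = UNIV\<close> boundedness is automatic in the cases used below: the Cuntz relations
  make the generators isometries, the anticommutation relations make them contractions.
\<close>

definition star_ops :: "nat set \<Rightarrow> 'a::complex_hilbert set \<Rightarrow> (nat \<Rightarrow> 'a \<Rightarrow> 'a) \<Rightarrow> bool" where
  "star_ops I D g \<longleftrightarrow>
     cvec.subspace D \<and> closure D = UNIV \<and>
     (\<forall>n\<in>I. clinear_on D (g n) \<and> (\<forall>x\<in>D. g n x \<in> D) \<and>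
        (\<forall>y\<in>D. \<exists>z\<in>D. \<forall>x\<in>D. cinner z x = cinner y (g n x)))"

definition orbit :: "nat set \<Rightarrow> 'a::complex_hilbert set \<Rightarrow> (nat \<Rightarrow> 'a \<Rightarrow> 'a) \<Rightarrow> 'a \<Rightarrow> 'a set" where
  "orbit I D g \<Omega> =
     cvec.span {foldr (\<lambda>A. A) As \<Omega> | As. set As \<subseteq> g ` I \<union> adj_on D ` g ` I}"

definition cuntz_rep :: "(nat \<Rightarrow> 'h \<Rightarrow> 'h::complex_hilbert) \<Rightarrow> bool" where
  "cuntz_rep t \<longleftrightarrow>
     star_ops {1, 2} UNIV t \<and>
     (\<forall>i\<in>{1, 2}. \<forall>j\<in>{1, 2}. \<forall>x. adj (t i) (t j x) = (if i = j then x else 0)) \<and>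
     (\<forall>x. t 1 (adj (t 1) x) + t 2 (adj (t 2) x) = x)"

definition boson_rep :: "'h::complex_hilbert set \<Rightarrow> (nat \<Rightarrow> 'h \<Rightarrow> 'h) \<Rightarrow> bool" where
  "boson_rep D b \<longleftrightarrow>
     star_ops {1..} D b \<and>
     (\<forall>n\<ge>1. \<forall>m\<ge>1. \<forall>x\<in>D.
        b n (adj_on D (b m) x) - adj_on D (b m) (b n x) = (if n = m then x else 0) \<and>
        b n (b m x) - b m (b n x) = 0 \<and>
        adj_on D (b n) (adj_on D (b m) x) - adj_on D (b m) (adj_on D (b n) x) = 0)"

definition fermion_rep :: "(nat \<Rightarrow> 'h \<Rightarrow> 'h::complex_hilbert) \<Rightarrow> bool" where
  "fermion_rep a \<longleftrightarrow>
     star_ops {1..} UNIV a \<and>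
     (\<forall>n\<ge>1. \<forall>m\<ge>1. \<forall>x.
        a n (adj (a m) x) + adj (a m) (a n x) = (if n = m then x else 0) \<and>
        a n (a m x) + a m (a n x) = 0 \<and>
        adj (a n) (adj (a m) x) + adj (a m) (adj (a n) x) = 0)"

definition bose_fock ::
  "'h::complex_hilbert set \<Rightarrow> (nat \<Rightarrow> 'h \<Rightarrow> 'h) \<Rightarrow> 'h \<Rightarrow> bool" where
  "bose_fock D b \<Omega> \<longleftrightarrow>
     boson_rep D b \<and> norm \<Omega> = 1 \<and> D = orbit {1..} D b \<Omega> \<and> (\<forall>n\<ge>1. b n \<Omega> = 0)"

definition fermi_fock :: "(nat \<Rightarrow> 'h \<Rightarrow> 'h::complex_hilbert) \<Rightarrow> 'h \<Rightarrow> bool" where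
  "fermi_fock a \<Omega> \<longleftrightarrow>
     fermion_rep a \<and> norm \<Omega> = 1 \<and> closure (orbit {1..} UNIV a \<Omega>) = UNIV \<and> (\<forall>n\<ge>1. a n \<Omega> = 0)"

definition particle_space ::
  "'h::complex_hilbert set \<Rightarrow> (nat \<Rightarrow> 'h \<Rightarrow> 'h) \<Rightarrow> 'h \<Rightarrow> nat \<Rightarrow> 'h set" where
  "particle_space D g \<Omega> n =
     (if n = 0 then cvec.span {\<Omega>}
      else closure (cvec.span
        {foldr (\<lambda>j. adj_on D (g j)) js \<Omega> | js. length js = n \<and> set js \<subseteq> {1..}}))"

definition cuntz_vacuum_rep :: "(nat \<Rightarrow> 'h \<Rightarrow> 'h::complex_hilbert) \<Rightarrow> 'h \<Rightarrow> bool" where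
  "cuntz_vacuum_rep t \<Omega> \<longleftrightarrow>
     cuntz_rep t \<and> norm \<Omega> = 1 \<and> closure (orbit {1, 2} UNIV t \<Omega>) = UNIV \<and> t 1 \<Omega> = \<Omega>"

definition rbs_domain :: "(nat \<Rightarrow> 'h \<Rightarrow> 'h::complex_hilbert) \<Rightarrow> 'h \<Rightarrow> 'h set" where
  "rbs_domain t \<Omega> = cvec.span {foldr t is \<Omega> | is. is \<noteq> [] \<and> set is \<subseteq> {1, 2}}"

definition s_op :: "(nat \<Rightarrow> 'h \<Rightarrow> 'h::complex_hilbert) \<Rightarrow> nat \<Rightarrow> 'h \<Rightarrow> 'h" where
  "s_op t m = (t 2 ^^ (m - 1)) \<circ> t 1"

text \<open>
  The sums below have finitely many nonzero terms at each vector of \<^term>\<open>rbs_domain t \<Omega>\<close>;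
  outside this domain the values carry no meaning. The index 0 is not used either.
\<close>

definition rho :: "(nat \<Rightarrow> 'h \<Rightarrow> 'h::complex_hilbert) \<Rightarrow> ('h \<Rightarrow> 'h) \<Rightarrow> 'h \<Rightarrow> 'h" where
  "rho t X v = (\<Sum>\<^sub>\<infinity>m\<in>{1..}. s_op t m (X (adj (s_op t m) v)))"

definition rbs :: "(nat \<Rightarrow> 'h \<Rightarrow> 'h::complex_hilbert) \<Rightarrow> nat \<Rightarrow> 'h \<Rightarrow> 'h" where
  "rbs t n = (rho t ^^ (n - 1))
     (\<lambda>v. \<Sum>\<^sub>\<infinity>m\<in>{1..}. complex_of_real (sqrt (real m)) *\<^sub>C s_op t m (adj (s_op t (m + 1)) v))"

definition zeta :: "(nat \<Rightarrow> 'h \<Rightarrow> 'h::complex_hilbert) \<Rightarrow> ('h \<Rightarrow> 'h) \<Rightarrow> 'h \<Rightarrow> 'h" where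
  "zeta t Y v = t 1 (Y (adj (t 1) v)) - t 2 (Y (adj (t 2) v))"

definition rfs :: "(nat \<Rightarrow> 'h \<Rightarrow> 'h::complex_hilbert) \<Rightarrow> nat \<Rightarrow> 'h \<Rightarrow> 'h" where
  "rfs t n = (zeta t ^^ (n - 1)) (t 1 \<circ> adj (t 2))"

text \<open>
  The intertwining relations \<open>V \<pi>(\<cdot>) V\<^sup>* = \<pi>'(\<cdot>)\<close>, stated on the generators and
  their adjoints.
\<close>

definition bose_intertwiner ::
  "(nat \<Rightarrow> 'h \<Rightarrow> 'h) \<Rightarrow> 'h \<Rightarrow> 'k set \<Rightarrow> (nat \<Rightarrow> 'k \<Rightarrow> 'k) \<Rightarrow> 'k
     \<Rightarrow> ('h::complex_hilbert \<Rightarrow> 'k::complex_hilbert) \<Rightarrow> bool" where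
  "bose_intertwiner t \<Omega> D\<^sub>B b \<Omega>\<^sub>B V \<longleftrightarrow>
     unitary V \<and> V ` rbs_domain t \<Omega> = D\<^sub>B \<and> V \<Omega> = \<Omega>\<^sub>B \<and>
     (\<forall>n\<ge>1. \<forall>x\<in>D\<^sub>B.
        V (rbs t n (adj V x)) = b n x \<and>
        V (adj_on (rbs_domain t \<Omega>) (rbs t n) (adj V x)) = adj_on D\<^sub>B (b n) x)"

definition fermi_intertwiner ::
  "(nat \<Rightarrow> 'h \<Rightarrow> 'h) \<Rightarrow> 'h \<Rightarrow> (nat \<Rightarrow> 'k \<Rightarrow> 'k) \<Rightarrow> 'k
     \<Rightarrow> ('h::complex_hilbert \<Rightarrow> 'k::complex_hilbert) \<Rightarrow> bool" where
  "fermi_intertwiner t \<Omega> a \<Omega>\<^sub>F V \<longleftrightarrow>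
     unitary V \<and> V \<Omega> = \<Omega>\<^sub>F \<and>
     (\<forall>n\<ge>1. \<forall>x.
        V (rfs t n (adj V x)) = a n x \<and>
        V (adj (rfs t n) (adj V x)) = adj (a n) x)"

definition A_op :: "(nat \<Rightarrow> 'h \<Rightarrow> 'h::complex_hilbert) \<Rightarrow> nat \<Rightarrow> nat \<Rightarrow> 'h \<Rightarrow> 'h" where
  "A_op a n m = foldr (\<lambda>j. adj (a j)) [n + 1..<n + m + 1]"

end

theory Submission
  imports Defs
begin

text \<open>
  Everything is computed in the Cuntz space, on the vectors \<open>t i\<^sub>1 (\<dots> (t i\<^sub>m \<Omega>))\<close>.
  Cutting such a word after each letter 1 and absorbing \<open>t 1 \<Omega> = \<Omega>\<close> writes it as
  \<open>S k\<^sub>1 (S k\<^sub>2 (\<dots> \<Omega>))\<close> with \<open>S k = t\<^sub>2\<^sup>k t\<^sub>1\<close>. There it can be read in two ways. As a boson state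
  it has \<open>k\<^sub>j\<close> particles in the mode \<open>j\<close>: the operator \<open>b\<^sub>1\<^sup>*\<close> sends \<open>S k x\<close> to
  \<open>sqrt (k + 1) S (k + 1) x\<close> (\<open>b_dag_1_S\<close>), and \<open>b\<^sub>n\<^sub>+\<^sub>1\<^sup>*\<close> leaves the first block alone and
  acts as \<open>b\<^sub>n\<^sup>*\<close> behind it (\<open>b_dag_Suc_S\<close>). As a fermion state, letter by letter (the
  word being continued by letters 1), the mode \<open>j\<close> is occupied exactly when the letter \<open>j\<close>
  is 2: the operator \<open>a\<^sub>1\<^sup>*\<close> turns a leading 1 into 2 and kills a leading 2, while \<open>a\<^sub>n\<^sub>+\<^sub>1\<^sup>*\<close> passes one letter, with a minus sign if the letter
  is 2 (\<open>f_dag_1_t1\<close>, \<open>f_dag_1_t2\<close>, \<open>f_dag_Suc_t1\<close>, \<open>f_dag_Suc_t2\<close>).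

  Hence \<open>(b\<^sub>1\<^sup>*)\<^sup>k\<close> puts the factor \<open>sqrt (k!)\<close> and a block of \<open>k\<close> letters 2 in front of a
  leading letter 1, and \<open>a\<^sub>1\<^sup>* \<dots> a\<^sub>k\<^sup>*\<close> produces the same block from \<open>k\<close> letters 1, without a sign
  because the rightmost factors act first and so only letters 1 are ever passed.
  A block inserted by bosons moves all later letters by \<open>k\<close> positions; this is the shift
  of the fermionic indices in \<open>ordered_product\<close>.

  In both readings the number of particles is the number of letters 2. Both \<open>n\<close>-particle spaces
  are therefore images of the closed span of the words with \<open>n\<close> letters 2
  (\<open>span_boson_products\<close>, \<open>span_fermion_products\<close>).
\<close>

section \<open>Inner products and adjoints\<close>

lemma cinner_add_left: "cinner (x + y) z = cinner x z + cinner y z"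
  by (metis cinner_add_right cinner_commute complex_cnj_add)

lemma cinner_scaleC_left: "cinner (c *\<^sub>C x) y = cnj c * cinner x y"
  by (metis cinner_commute cinner_scaleC_right complex_cnj_mult)

lemma cinner_zero_right [simp]: "cinner x 0 = 0"
  using cinner_add_right[of x 0 0] by simp

lemma cinner_zero_left [simp]: "cinner 0 x = 0"
  using cinner_add_left[of 0 0 x] by simp

lemma cinner_minus_right: "cinner x (- y) = - cinner x y"
  using cinner_add_right[of x y "- y"] by (simp add: eq_neg_iff_add_eq_0 add.commute)

lemma cinner_diff_right: "cinner x (y - z) = cinner x y - cinner x z"
  using cinner_add_right[of x y "- z"] by (simp add: cinner_minus_right)

lemma cinner_diff_left: "cinner (y - z) x = cinner y x - cinner z x"
  by (metis cinner_commute cinner_diff_right complex_cnj_diff)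

lemma cinner_self_eq_0_iff: "cinner x x = 0 \<longleftrightarrow> x = 0"
  by (simp add: cinner_self)

text \<open>
  Testing against \<open>D\<close> separates the points of \<open>D\<close>, since the difference of two points is itself a
  test vector. This makes formal adjoints with values in \<open>D\<close> unique.
\<close>

lemma cinner_ext_on:
  assumes "cvec.subspace D" "z \<in> D" "z' \<in> D" "\<And>x. x \<in> D \<Longrightarrow> cinner z x = cinner z' x"
  shows "z = z'"
proof -
  have "z - z' \<in> D"
    using assms by (simp add: cvec.subspace_diff)
  then have "cinner (z - z') (z - z') = 0"
    using assms(4)[of "z - z'"] by (simp add: cinner_diff_left)
  then show ?thesis by (simp add: cinner_self_eq_0_iff)
qed

lemma adj_on_eqI:
  assumes "cvec.subspace D" "z \<in> D" "\<And>x. x \<in> D \<Longrightarrow> cinner z x = cinner y (A x)"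
  shows "adj_on D A y = z"
  unfolding adj_on_def
  by (rule the_equality) (use assms in \<open>auto intro!: cinner_ext_on[OF assms(1)]\<close>)

definition has_adj_on :: "'a::complex_hilbert set \<Rightarrow> ('a \<Rightarrow> 'a) \<Rightarrow> bool" where
  "has_adj_on D A \<longleftrightarrow> (\<forall>y\<in>D. \<exists>z\<in>D. \<forall>x\<in>D. cinner z x = cinner y (A x))"

lemma
  assumes "cvec.subspace D" "has_adj_on D A" "y \<in> D"
  shows adj_on_in: "adj_on D A y \<in> D"
    and cinner_adj_on: "x \<in> D \<Longrightarrow> cinner (adj_on D A y) x = cinner y (A x)"
proof -
  obtain z where z: "z \<in> D" "\<forall>x\<in>D. cinner z x = cinner y (A x)"
    using assms unfolding has_adj_on_def by blast
  have "adj_on D A y = z" by (rule adj_on_eqI) (use assms z in auto)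
  then show "adj_on D A y \<in> D" "x \<in> D \<Longrightarrow> cinner (adj_on D A y) x = cinner y (A x)"
    using z by auto
qed

lemma clinear_on_adj_on:
  assumes "cvec.subspace D" "has_adj_on D A"
  shows "clinear_on D (adj_on D A)"
  unfolding clinear_on_def
  using assms
  by (auto intro!: adj_on_eqI cvec.subspace_add cvec.subspace_scale
      simp: adj_on_in cinner_adj_on cinner_add_left cinner_scaleC_left)

lemma clinear_on_0:
  assumes "clinear_on D f" "0 \<in> D"
  shows "f 0 = 0"
proof -
  have "f (0 *\<^sub>C 0) = 0 *\<^sub>C f 0"
    using assms unfolding clinear_on_def by blast
  then show ?thesis by simp
qed

lemma clinear_on_span_into:
  assumes f: "clinear_on E f" and E: "cvec.subspace E" "A \<subseteq> E"
    and into: "\<And>x. x \<in> A \<Longrightarrow> f x \<in> cvec.span B" and x: "x \<in> cvec.span A"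
  shows "f x \<in> cvec.span B"
proof -
  have "x \<in> E \<and> f x \<in> cvec.span B"
    using x
  proof (induction rule: cvec.span_induct_alt)
    case base
    then show ?case
      using clinear_on_0[OF f] E(1) by (simp add: cvec.subspace_0 cvec.span_zero)
  next
    case (step c x y)
    then have "x \<in> E" "c *\<^sub>C x \<in> E" "y \<in> E" using E by (auto simp: cvec.subspace_scale)
    then have "f (c *\<^sub>C x + y) = c *\<^sub>C f x + f y"
      using f unfolding clinear_on_def by simp
    then show ?case
      using step into E \<open>c *\<^sub>C x \<in> E\<close> \<open>y \<in> E\<close>
      by (simp add: cvec.subspace_add cvec.span_add cvec.span_scale)
  qed
  then show ?thesis ..
qed

lemma cinner_eq_on_span:
  assumes f: "clinear_on (cvec.span A) f"
    and eq: "\<And>x. x \<in> A \<Longrightarrow> cinner z x = cinner y (f x)" and x: "x \<in> cvec.span A"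
  shows "cinner z x = cinner y (f x)"
proof -
  have "x \<in> cvec.span A \<and> cinner z x = cinner y (f x)"
    using x
  proof (induction rule: cvec.span_induct_alt)
    case base
    then show ?case using clinear_on_0[OF f cvec.span_zero] by (simp add: cvec.span_zero)
  next
    case (step c u v)
    then have in_span: "u \<in> cvec.span A" "c *\<^sub>C u \<in> cvec.span A" "v \<in> cvec.span A"
      by (auto intro: cvec.span_base cvec.span_scale)
    then have "f (c *\<^sub>C u + v) = c *\<^sub>C f u + f v"
      using f unfolding clinear_on_def by simp
    with step eq in_span show ?case
      by (simp add: cinner_add_right cinner_scaleC_right cvec.span_add)
  qed
  then show ?thesis ..
qed

lemma unitary_linear:
  assumes "unitary V"
  shows "V (x + y) = V x + V y" "V (c *\<^sub>C x) = c *\<^sub>C V x"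
  using assms unfolding unitary_def clinear_on_def by auto

lemma unitary_cinner: "unitary V \<Longrightarrow> cinner (V x) (V y) = cinner x y"
  unfolding unitary_def by simp

lemma unitary_adj_apply: "unitary V \<Longrightarrow> adj V (V x) = x"
  by (rule adj_on_eqI) (simp_all add: cvec.subspace_UNIV unitary_cinner)

lemma unitary_apply_adj: "unitary V \<Longrightarrow> V (adj V y) = y"
  using unitary_adj_apply[of V] unfolding unitary_def by (metis surjE)

lemma unitary_adj:
  assumes V: "unitary V"
  shows "unitary (adj V)"
  unfolding unitary_def clinear_on_def
proof (intro conjI ballI allI)
  fix x y c
  obtain x' y' where xy: "x = V x'" "y = V y'"
    using V unfolding unitary_def by (blast elim: surjE)
  show "adj V (x + y) = adj V x + adj V y" "adj V (c *\<^sub>C x) = c *\<^sub>C adj V x"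
    "cinner (adj V x) (adj V y) = cinner x y"
    using V unitary_adj_apply[OF V, of "x' + y'"] unitary_adj_apply[OF V, of "c *\<^sub>C x'"]
    by (simp_all add: xy unitary_adj_apply unitary_linear unitary_cinner)
  show "surj (adj V)"
    using unitary_adj_apply[OF V] by (rule surjI)
qed

lemma unitary_image_iff:
  assumes V: "unitary V"
  shows "y \<in> V ` X \<longleftrightarrow> adj V y \<in> X"
proof
  show "adj V y \<in> X" if "y \<in> V ` X"
    using that by (auto simp: unitary_adj_apply[OF V])
  show "y \<in> V ` X" if "adj V y \<in> X"
    using imageI[OF that, of V] by (simp add: unitary_apply_adj[OF V])
qed

lemma unitary_diff: "unitary V \<Longrightarrow> V (x - y) = V x - V y"
  using unitary_linear(1)[of V "x - y" y] by (simp add: algebra_simps)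

lemma unitary_continuous:
  assumes "unitary V"
  shows "continuous_on UNIV V"
proof -
  have "norm (V x) = norm x" for x
  proof -
    have "complex_of_real ((norm (V x))\<^sup>2) = complex_of_real ((norm x)\<^sup>2)"
      using unitary_cinner[OF assms, of x x] by (simp only: cinner_self)
    then have "(norm (V x))\<^sup>2 = (norm x)\<^sup>2" by (simp only: of_real_eq_iff)
    then show ?thesis by simp
  qed
  then have "dist (V x) (V y) = dist x y" for x y
    by (simp add: dist_norm flip: unitary_diff[OF assms])
  then show ?thesis
    unfolding continuous_on_iff by auto
qed

lemma unitary_image_closure:
  assumes V: "unitary V"
  shows "V ` closure S = closure (V ` S)"
proof
  show "V ` closure S \<subseteq> closure (V ` S)"
    by (rule image_closure_subset)
      (auto intro: continuous_on_subset[OF unitary_continuous[OF V]] closure_subset[THEN subsetD])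
  have "adj V ` closure (V ` S) \<subseteq> closure (adj V ` V ` S)"
    by (rule image_closure_subset)
      (auto intro: continuous_on_subset[OF unitary_continuous[OF unitary_adj[OF V]]]
        closure_subset[THEN subsetD])
  also have "adj V ` V ` S = S"
    by (simp add: image_image unitary_adj_apply[OF V])
  finally show "closure (V ` S) \<subseteq> V ` closure S"
    by (auto intro!: unitary_image_iff[OF V, THEN iffD2])
qed

lemma unitary_image_span:
  assumes V: "unitary V"
  shows "V ` cvec.span S = cvec.span (V ` S)"
proof
  have lin: "clinear_on UNIV V" "clinear_on UNIV (adj V)"
    using V unitary_adj[OF V] by (simp_all add: unitary_def)
  have "V x \<in> cvec.span (V ` S)" if "x \<in> cvec.span S" for x
    by (rule clinear_on_span_into[OF lin(1) cvec.subspace_UNIV subset_UNIV _ that])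
      (blast intro: cvec.span_base)
  then show "V ` cvec.span S \<subseteq> cvec.span (V ` S)" by blast
  have "adj V y \<in> cvec.span S" if "y \<in> cvec.span (V ` S)" for y
    by (rule clinear_on_span_into[OF lin(2) cvec.subspace_UNIV subset_UNIV _ that])
      (auto simp: unitary_adj_apply[OF V] intro: cvec.span_base)
  then show "cvec.span (V ` S) \<subseteq> V ` cvec.span S"
    by (auto intro!: unitary_image_iff[OF V, THEN iffD2])
qed

text \<open>
  The two induction schemes that move an intertwining relation, valid on an invariant domain,
  through a product of operators. They serve both for the unitaries and for \<open>t\<^sub>1\<^sup>r\<close>, which intertwines
  creation operators with those of shifted index.
\<close>

lemma foldr_intertwine:
  assumes "x = \<phi> x0" "x0 \<in> D" "\<And>i y. i \<in> set is \<Longrightarrow> y \<in> D \<Longrightarrow> g i y \<in> D \<and> f i (\<phi> y) = \<phi> (g i y)"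
  shows "foldr g is x0 \<in> D \<and> foldr f is x = \<phi> (foldr g is x0)"
  using assms by (induction "is") auto

lemma funpow_intertwine:
  assumes "x0 \<in> D" "\<And>y. y \<in> D \<Longrightarrow> g y \<in> D \<and> f (\<phi> y) = \<phi> (g y)"
  shows "(g ^^ k) x0 \<in> D \<and> (f ^^ k) (\<phi> x0) = \<phi> ((g ^^ k) x0)"
  using assms by (induction k) auto

section \<open>Vacuum words\<close>

locale cuntz_vacuum =
  fixes t :: "nat \<Rightarrow> 'h \<Rightarrow> 'h::complex_hilbert" and \<Omega> :: 'h
  assumes vacuum_rep: "cuntz_vacuum_rep t \<Omega>"
begin

abbreviation "D \<equiv> rbs_domain t \<Omega>"
abbreviation S :: "nat \<Rightarrow> 'h \<Rightarrow> 'h" where "S k \<equiv> s_op t (Suc k)"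

lemma S_0 [simp]: "S 0 x = t 1 x"
  by (simp add: s_op_def)

lemma S_Suc: "S (Suc k) x = t 2 (S k x)"
  by (simp add: s_op_def)

lemma t1_vacuum: "t 1 \<Omega> = \<Omega>"
  using vacuum_rep unfolding cuntz_vacuum_rep_def by simp

lemma t_linear: "i \<in> {1, 2} \<Longrightarrow> clinear_on UNIV (t i)"
  using vacuum_rep unfolding cuntz_vacuum_rep_def cuntz_rep_def star_ops_def by auto

lemma t_has_adj: "i \<in> {1, 2} \<Longrightarrow> has_adj_on UNIV (t i)"
  using vacuum_rep unfolding cuntz_vacuum_rep_def cuntz_rep_def star_ops_def has_adj_on_def by auto

lemma cinner_adj_t: "i \<in> {1, 2} \<Longrightarrow> cinner (adj (t i) y) x = cinner y (t i x)"
  by (rule cinner_adj_on) (simp_all add: cvec.subspace_UNIV t_has_adj)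

lemma cinner_t_adj: "i \<in> {1, 2} \<Longrightarrow> cinner x (adj (t i) y) = cinner (t i x) y"
  by (metis cinner_adj_t cinner_commute)

lemma adj_t_t: "i \<in> {1, 2} \<Longrightarrow> j \<in> {1, 2} \<Longrightarrow> adj (t i) (t j x) = (if i = j then x else 0)"
  using vacuum_rep unfolding cuntz_vacuum_rep_def cuntz_rep_def by auto

lemma cinner_t_t:
  "i \<in> {1, 2} \<Longrightarrow> j \<in> {1, 2} \<Longrightarrow> cinner (t i x) (t j y) = (if i = j then cinner x y else 0)"
  by (metis cinner_t_adj adj_t_t cinner_zero_right)

lemma t_0 [simp]: "t 1 0 = 0" "t 2 0 = 0" "t (Suc 0) 0 = 0"
  using clinear_on_0[OF t_linear] by auto

lemma t_scaleC: "t 1 (c *\<^sub>C x) = c *\<^sub>C t 1 x" "t 2 (c *\<^sub>C x) = c *\<^sub>C t 2 x"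
  using t_linear unfolding clinear_on_def by auto

lemma S_0_right [simp]: "S k 0 = 0"
  by (induction k) (simp_all add: S_Suc del: S_0, simp)

lemma cinner_S_S: "cinner (S k x) (S l y) = (if k = l then cinner x y else 0)"
proof (induction k arbitrary: l)
  case 0
  then show ?case by (cases l) (simp_all add: S_Suc cinner_t_t del: One_nat_def)
next
  case (Suc k)
  then show ?case by (cases l) (simp_all add: S_Suc cinner_t_t del: One_nat_def)
qed

lemma adj_S_S: "adj (S k) (S l x) = (if k = l then x else 0)"
  by (rule adj_on_eqI) (auto simp: cvec.subspace_UNIV cinner_S_S)

text \<open>
  The index counts the letters 2. Words are built from whole blocks \<open>t\<^sub>2\<^sup>k t\<^sub>1\<close>, the shape on which
  the boson operators act; letterwise induction is recovered in \<open>word_cases_t\<close>.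
\<close>

inductive word :: "nat \<Rightarrow> 'h \<Rightarrow> bool" where
  word_vacuum: "word 0 \<Omega>"
| word_S: "word n x \<Longrightarrow> word (k + n) (S k x)"

lemma word_casesE:
  assumes "word n x"
  obtains k n' x' where "x = S k x'" "word n' x'" "n = k + n'"
  using assms
proof cases
  case word_vacuum
  then show ?thesis using that[of 0 \<Omega> 0] word.word_vacuum by (simp add: t1_vacuum[simplified])
qed (use that in auto)

lemma word_t1: "word n x \<Longrightarrow> word n (t 1 x)"
  using word_S[of n x 0] by simp

lemma word_t2: "word n x \<Longrightarrow> word (Suc n) (t 2 x)"
  by (erule word_casesE) (use word_S[of _ _ "Suc _"] in \<open>auto simp: S_Suc\<close>)

lemma domain_eq_span_words: "D = cvec.span {x. \<exists>n. word n x}"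
proof -
  have "\<exists>n. word n (foldr t is \<Omega>)" if "set is \<subseteq> {1, 2}" for "is"
    using that
  proof (induction "is")
    case Nil
    then show ?case using word_vacuum by auto
  next
    case (Cons i "is")
    then obtain n where n: "word n (foldr t is \<Omega>)" by auto
    have "i = 1 \<or> i = 2" using Cons.prems by auto
    then show ?case using word_t1[OF n] word_t2[OF n] by auto
  qed
  moreover have "\<exists>is. x = foldr t is \<Omega> \<and> is \<noteq> [] \<and> set is \<subseteq> {1, 2}" if "word n x" for n x
    using that
  proof induction
    case word_vacuum
    show ?case by (rule exI[of _ "[1]"]) (simp add: t1_vacuum[simplified])
  next
    case (word_S n x k)
    then obtain "is" where "x = foldr t is \<Omega>" "set is \<subseteq> {1, 2}" by blast
    then show ?case
      by (intro exI[of _ "replicate k 2 @ 1 # is"]) (auto simp: s_op_def)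
  qed
  ultimately have
    "{foldr t is \<Omega> | is. is \<noteq> [] \<and> set is \<subseteq> {1, 2}} = {x. \<exists>n. word n x}"
    by (intro equalityI subsetI) (force, simp, metis)
  then show ?thesis by (simp add: rbs_domain_def)
qed

lemma subspace_D: "cvec.subspace D"
  by (simp add: rbs_domain_def)

lemma word_in_D: "word n x \<Longrightarrow> x \<in> D"
  unfolding domain_eq_span_words by (rule cvec.span_base) auto

lemma vacuum_in_D: "\<Omega> \<in> D"
  using word_in_D word_vacuum by blast

lemma t_in_D:
  assumes "x \<in> D" shows "t 1 x \<in> D" "t 2 x \<in> D"
proof -
  have "t i x \<in> D" if "i \<in> {1, 2}" for i
    using assms unfolding domain_eq_span_words
    by (rule clinear_on_span_into[OF t_linear[OF that] cvec.subspace_UNIV subset_UNIV, rotated])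
      (use that in \<open>auto intro!: cvec.span_base dest: word_t1 word_t2 simp del: One_nat_def\<close>)
  then show "t 1 x \<in> D" "t 2 x \<in> D" by simp_all
qed

lemma S_in_D: "x \<in> D \<Longrightarrow> S k x \<in> D"
  by (induction k) (use t_in_D in \<open>auto simp: S_Suc\<close>)

lemma S_linear: "clinear_on UNIV (S k)"
proof (induction k)
  case 0
  then show ?case using t_linear[of 1] by (simp add: clinear_on_def)
next
  case (Suc k)
  then show ?case using t_linear[of 2] by (simp add: clinear_on_def S_Suc del: S_0)
qed

lemma S_scaleC: "S k (c *\<^sub>C x) = c *\<^sub>C S k x"
  using S_linear unfolding clinear_on_def by blast

lemma t1_funpow_scaleC: "(t 1 ^^ r) (c *\<^sub>C x) = c *\<^sub>C (t 1 ^^ r) x"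
  by (induction r) (simp_all add: t_scaleC del: One_nat_def)

lemma t1_funpow_vacuum: "(t 1 ^^ r) \<Omega> = \<Omega>"
  by (induction r) (simp_all add: t1_vacuum del: One_nat_def)

lemma t1_funpow_in_D: "x \<in> D \<Longrightarrow> (t 1 ^^ r) x \<in> D"
  by (induction r) (auto intro: t_in_D[unfolded One_nat_def])

section \<open>Bosonic creation operators on words\<close>

text \<open>
  The ranges of the isometries \<open>S k\<close> are orthogonal, so on a vector in one of these ranges
  at most one term of the defining series of the boson operators is nonzero.
\<close>

lemma infsum_over_S:
  assumes "\<And>m. m \<noteq> l \<Longrightarrow> f (Suc m) = (0::'h)"
  shows "(\<Sum>\<^sub>\<infinity>m\<in>{1..}. f m) = f (Suc l)"
proof -
  have "infsum f {1..} = infsum f {Suc l}"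
  proof (rule infsum_cong_neutral)
    fix m assume "m \<in> {1..} - {Suc l}"
    then show "f m = 0" using assms[of "m - 1"] by (cases m) auto
  qed auto
  then show ?thesis by simp
qed

lemma rbs_1_S: "rbs t 1 (S l x) = (if l = 0 then 0 else complex_of_real (sqrt l) *\<^sub>C S (l - 1) x)"
proof -
  have "rbs t 1 (S l x) = (\<Sum>\<^sub>\<infinity>m\<in>{1..}. complex_of_real (sqrt (real m)) *\<^sub>C
      s_op t m (adj (s_op t (m + 1)) (S l x)))"
    by (simp add: rbs_def)
  \<comment> \<open>for \<open>l = 0\<close> all terms vanish, and the sum collapses to its first term just as well\<close>
  also have "\<dots> = complex_of_real (sqrt (Suc (l - 1))) *\<^sub>C
      S (l - 1) (adj (s_op t (Suc (l - 1) + 1)) (S l x))"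
    by (rule infsum_over_S) (auto simp: adj_S_S)
  finally show ?thesis by (auto simp: adj_S_S)
qed

lemma rbs_Suc: "n \<ge> 1 \<Longrightarrow> rbs t (Suc n) = rho t (rbs t n)"
  by (cases n) (simp_all add: rbs_def)

lemma rho_S: "X 0 = 0 \<Longrightarrow> rho t X (S l x) = S l (X x)"
  unfolding rho_def by (subst infsum_over_S[of l]) (auto simp: adj_S_S)

lemma rbs_0_right: "n \<ge> 1 \<Longrightarrow> rbs t n 0 = 0"
proof (induction n rule: nat_induct_at_least)
  case base
  then show ?case using rbs_1_S[of 0 0] by simp
next
  case (Suc n)
  then show ?case using rho_S[of "rbs t n" 0 0] by (simp add: rbs_Suc)
qed

lemma rbs_Suc_S: "n \<ge> 1 \<Longrightarrow> rbs t (Suc n) (S l x) = S l (rbs t n x)"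
  by (simp add: rbs_Suc rho_S rbs_0_right)

end

text \<open>
  The series defining the boson operators do not show their linearity and adjointability on \<open>D\<close>;
  both properties are read off from the Bose-Fock space in \<open>rbs_representation_of_intertwiner\<close>.
\<close>

locale rbs_representation = cuntz_vacuum +
  assumes rbs_linear: "n \<ge> 1 \<Longrightarrow> clinear_on D (rbs t n)"
    and rbs_has_adj: "n \<ge> 1 \<Longrightarrow> has_adj_on D (rbs t n)"
begin

abbreviation b_dag :: "nat \<Rightarrow> 'a \<Rightarrow> 'a" where "b_dag n \<equiv> adj_on D (rbs t n)"

lemma b_dag_in_D: "n \<ge> 1 \<Longrightarrow> x \<in> D \<Longrightarrow> b_dag n x \<in> D"
  by (simp add: adj_on_in subspace_D rbs_has_adj)

lemma b_dag_linear: "n \<ge> 1 \<Longrightarrow> clinear_on D (b_dag n)"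
  by (simp add: clinear_on_adj_on subspace_D rbs_has_adj)

lemma b_dag_scaleC: "n \<ge> 1 \<Longrightarrow> x \<in> D \<Longrightarrow> b_dag n (c *\<^sub>C x) = c *\<^sub>C b_dag n x"
  using b_dag_linear unfolding clinear_on_def by blast

text \<open>
  Since \<open>D\<close> is spanned by words and each word begins with a block, an adjoint is determined by its
  matrix coefficients at vectors \<open>S l y\<close>.
\<close>

lemma b_dag_eqI:
  assumes "n \<ge> 1" "z \<in> D"
    "\<And>l k y. word k y \<Longrightarrow> cinner z (S l y) = cinner x (rbs t n (S l y))"
  shows "b_dag n x = z"
proof (rule adj_on_eqI[OF subspace_D assms(2)])
  fix y assume "y \<in> D"
  then have y: "y \<in> cvec.span {x. \<exists>n. word n x}" by (simp only: domain_eq_span_words)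
  show "cinner z y = cinner x (rbs t n y)"
  proof (rule cinner_eq_on_span[OF _ _ y])
    show "clinear_on (cvec.span {x. \<exists>n. word n x}) (rbs t n)"
      using rbs_linear[OF assms(1)] by (simp only: domain_eq_span_words)
    fix w assume "w \<in> {x. \<exists>n. word n x}"
    then obtain m where "word m w" by blast
    then obtain l k w' where "w = S l w'" "word k w'" by (rule word_casesE)
    then show "cinner z w = cinner x (rbs t n w)" using assms(3) by blast
  qed
qed

lemma b_dag_1_S:
  assumes "x \<in> D"
  shows "b_dag 1 (S k x) = complex_of_real (sqrt (Suc k)) *\<^sub>C S (Suc k) x"
proof (rule b_dag_eqI)
  show "complex_of_real (sqrt (Suc k)) *\<^sub>C S (Suc k) x \<in> D"
    using assms by (intro cvec.subspace_scale subspace_D S_in_D)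
  fix l n y
  show "cinner (complex_of_real (sqrt (Suc k)) *\<^sub>C S (Suc k) x) (S l y)
      = cinner (S k x) (rbs t 1 (S l y))"
    by (cases l) (simp_all add: rbs_1_S cinner_S_S cinner_scaleC_left cinner_scaleC_right
        del: S_0 One_nat_def)
qed simp

lemma b_dag_Suc_S:
  assumes "n \<ge> 1" "x \<in> D"
  shows "b_dag (Suc n) (S k x) = S k (b_dag n x)"
proof (rule b_dag_eqI)
  show "S k (b_dag n x) \<in> D"
    using assms by (intro S_in_D b_dag_in_D)
  fix l m y
  assume "word m y"
  then have "cinner (b_dag n x) y = cinner x (rbs t n y)"
    using assms by (simp add: cinner_adj_on subspace_D rbs_has_adj word_in_D)
  then show "cinner (S k (b_dag n x)) (S l y) = cinner (S k x) (rbs t (Suc n) (S l y))"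
    using assms by (simp add: rbs_Suc_S cinner_S_S)
qed simp

lemma b_dag_1_funpow_t1:
  assumes "x \<in> D"
  shows "(b_dag 1 ^^ k) (t 1 x) = complex_of_real (sqrt (fact k)) *\<^sub>C S k x"
proof (induction k)
  case 0
  then show ?case by simp
next
  case (Suc k)
  then show ?case
    using assms
    by (simp add: b_dag_scaleC S_in_D b_dag_1_S[unfolded One_nat_def] real_sqrt_mult mult.commute
        del: S_0 flip: of_real_mult)
qed

lemma b_dag_funpow_in_D: "n \<ge> 1 \<Longrightarrow> x \<in> D \<Longrightarrow> (b_dag n ^^ k) x \<in> D"
  by (induction k) (auto intro: b_dag_in_D)

lemma b_dag_shift:
  assumes "n \<ge> 1" "x \<in> D"
  shows "b_dag (n + r) ((t 1 ^^ r) x) = (t 1 ^^ r) (b_dag n x)"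
proof (induction r)
  case (Suc r)
  have "b_dag (Suc (n + r)) (S 0 ((t 1 ^^ r) x)) = S 0 (b_dag (n + r) ((t 1 ^^ r) x))"
    using assms t1_funpow_in_D by (intro b_dag_Suc_S) auto
  then show ?case using Suc by simp
qed simp

lemma b_dag_funpow_shift:
  assumes "n \<ge> 1" "x \<in> D"
  shows "(b_dag (n + r) ^^ k) ((t 1 ^^ r) x) = (t 1 ^^ r) ((b_dag n ^^ k) x)"
  using funpow_intertwine[of x D "b_dag n" "b_dag (n + r)" "t 1 ^^ r" k] assms b_dag_shift b_dag_in_D by blast

end

section \<open>Fermionic creation operators on words\<close>

context cuntz_vacuum
begin

abbreviation f_dag :: "nat \<Rightarrow> 'h \<Rightarrow> 'h" where "f_dag n \<equiv> adj (rfs t n)"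

text \<open>
  The map \<open>zeta\<close> commutes with taking adjoints, because \<open>t\<^sub>i (\<cdot>) t\<^sub>i\<^sup>*\<close> does.
\<close>

lemma f_dag_recursion:
  assumes "n \<ge> 1"
  shows "f_dag n = (zeta t ^^ (n - 1)) (t 2 \<circ> adj (t 1)) \<and> has_adj_on UNIV (rfs t n)"
proof -
  have zeta_adj: "cinner (zeta t Y' y) x = cinner y (zeta t Y x)"
    if "\<And>x y. cinner (Y' y) x = cinner y (Y x)" for Y Y' x y
    unfolding zeta_def
    by (simp add: cinner_diff_left cinner_diff_right that cinner_adj_t
        flip: cinner_t_adj del: One_nat_def)
  have "cinner ((zeta t ^^ k) (t 2 \<circ> adj (t 1)) y) x
      = cinner y ((zeta t ^^ k) (t 1 \<circ> adj (t 2)) x)" for k x y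
  proof (induction k arbitrary: x y)
    case 0
    then show ?case by (simp add: cinner_adj_t flip: cinner_t_adj del: One_nat_def)
  next
    case (Suc k)
    then show ?case unfolding funpow.simps comp_apply by (rule zeta_adj)
  qed
  then show ?thesis
    unfolding has_adj_on_def
    by (auto simp: rfs_def cvec.subspace_UNIV intro!: ext adj_on_eqI)
qed

lemma f_dag_linear: "n \<ge> 1 \<Longrightarrow> clinear_on UNIV (f_dag n)"
  using f_dag_recursion by (intro clinear_on_adj_on cvec.subspace_UNIV) blast

lemma f_dag_1_t1: "f_dag 1 (t 1 x) = t 2 x"
  using f_dag_recursion[of 1] by (simp add: adj_t_t[of 1 1, simplified])

lemma f_dag_1_t2: "f_dag 1 (t 2 x) = 0"
  using f_dag_recursion[of 1] adj_t_t[of 1 2] by simp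

lemma f_dag_Suc: "n \<ge> 1 \<Longrightarrow> f_dag (Suc n) = zeta t (f_dag n)"
  using f_dag_recursion[of n] f_dag_recursion[of "Suc n"] by (cases n) auto

lemma f_dag_0_right: "n \<ge> 1 \<Longrightarrow> f_dag n 0 = 0"
  using clinear_on_0[OF f_dag_linear] by simp

lemma f_dag_Suc_t1: "n \<ge> 1 \<Longrightarrow> f_dag (Suc n) (t 1 x) = t 1 (f_dag n x)"
  by (simp add: f_dag_Suc zeta_def adj_t_t f_dag_0_right del: One_nat_def)

lemma f_dag_Suc_t2: "n \<ge> 1 \<Longrightarrow> f_dag (Suc n) (t 2 x) = - t 2 (f_dag n x)"
  by (simp add: f_dag_Suc zeta_def adj_t_t f_dag_0_right del: One_nat_def)

lemma f_dag_shift: "n \<ge> 1 \<Longrightarrow> f_dag (n + r) ((t 1 ^^ r) x) = (t 1 ^^ r) (f_dag n x)"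
  by (induction r) (simp_all add: f_dag_Suc_t1 del: One_nat_def)

abbreviation "A \<equiv> A_op (rfs t)"

lemma foldr_f_dag_shift:
  assumes "\<forall>j\<in>set js. j \<ge> 1"
  shows "foldr f_dag (map (\<lambda>j. j + r) js) ((t 1 ^^ r) x) = (t 1 ^^ r) (foldr f_dag js x)"
  using assms by (induction js) (simp_all add: f_dag_shift del: One_nat_def)

lemma A_shift: "A (n + r) m ((t 1 ^^ r) x) = (t 1 ^^ r) (A n m x)"
proof -
  have "map (\<lambda>j. j + r) [n + 1..<n + m + 1] = [n + r + 1..<n + r + m + 1]"
    by (rule nth_equalityI) (auto simp del: upt_Suc)
  then show ?thesis
    using foldr_f_dag_shift[of "[n + 1..<n + m + 1]" r x] by (simp add: A_op_def del: upt_Suc)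
qed

lemma A_Suc_right: "A n (Suc k) x = A n k (f_dag (n + k + 1) x)"
  by (simp add: A_op_def)

text \<open>
  The factor \<open>a\<^sub>k\<^sup>*\<close> acts first and turns the \<open>k\<close>-th letter into 2, then \<open>a\<^sub>k\<^sub>-\<^sub>1\<^sup>*\<close> the one before it:
  no letter 2 is ever passed, so no sign appears.
\<close>

lemma A_0_t1_funpow: "A 0 k ((t 1 ^^ k) x) = (t 2 ^^ k) x"
proof (induction k arbitrary: x)
  case 0
  then show ?case by (simp add: A_op_def)
next
  case (Suc k)
  have "A 0 (Suc k) ((t 1 ^^ Suc k) x) = A 0 k (f_dag (1 + k) ((t 1 ^^ k) (t 1 x)))"
    by (simp add: A_Suc_right funpow_swap1)
  also have "\<dots> = A 0 k ((t 1 ^^ k) (t 2 x))"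
    by (subst f_dag_shift) (simp_all only: f_dag_1_t1 le_refl)
  finally show ?case using Suc by (simp add: funpow_swap1)
qed


end

section \<open>Ordered products of creation operators\<close>

context rbs_representation
begin

text \<open>
  The product is read off from its outermost factor. The offset \<open>q\<close> counts the boson modes already
  stripped off together with their letters 1; each step strips the modes up to \<open>n p\<close>. The remaining
  factors have larger indices, so they act behind a prefix \<open>t\<^sub>1\<^sup>r\<^sup>+\<^sup>1\<close> of the vacuum in the bosonic
  case and behind \<open>t\<^sub>1\<^sup>r\<^sup>+\<^sup>k\<^sup>+\<^sup>1\<close> in the fermionic one, where \<open>k = k p\<close>; the \<open>k\<close> additional letters 1
  are those that become the block of letters 2.
\<close>

lemma ordered_product:
  assumes "strict_mono_on {1..m} n" "1 \<le> p" "p \<le> m + 1" "\<forall>i\<in>{p..m}. q < n i"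
  shows "foldr (\<lambda>i. b_dag (n i - q) ^^ k i) [p..<m + 1] \<Omega> =
    complex_of_real (sqrt (\<Prod>i=p..m. fact (k i))) *\<^sub>C
      foldr (\<lambda>i. A (n i + (\<Sum>j=p..<i. k j) - 1 - q) (k i)) [p..<m + 1] \<Omega>"
  using assms(3,2,4)
proof (induction arbitrary: q rule: inc_induct)
  case base
  then show ?case by simp
next
  case (step p)
  \<comment> \<open>the number of letters 1 in front of the block of mode \<open>n p\<close>\<close>
  define r where "r = n p - q - 1"
  have p: "p \<le> m" "q < n p" using step.hyps step.prems(2) by simp_all
  then have r: "n p - q = r + 1" by (simp add: r_def)
  have above: "n p < n i" if "i \<in> {Suc p..m}" for i
    using assms(1) step(4) that unfolding strict_mono_on_def by auto
  have upt: "[p..<m + 1] = p # [Suc p..<m + 1]"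
    using p by (simp add: upt_conv_Cons)

  let ?L = "foldr (\<lambda>i. b_dag (n i - n p) ^^ k i) [Suc p..<m + 1] \<Omega>"
  let ?R = "foldr (\<lambda>i. A (n i + (\<Sum>j=Suc p..<i. k j) - 1 - n p) (k i)) [Suc p..<m + 1] \<Omega>"
  let ?C = "complex_of_real (sqrt (\<Prod>i=Suc p..m. fact (k i)))"
  let ?c = "complex_of_real (sqrt (fact (k p)))"
  have IH: "?L = ?C *\<^sub>C ?R"
    using step above by auto

  have bose: "?L \<in> D \<and> foldr (\<lambda>i. b_dag (n i - q) ^^ k i) [Suc p..<m + 1] \<Omega> = (t 1 ^^ (r + 1)) ?L"
  proof (rule foldr_intertwine[where D = D])
    show "\<Omega> = (t 1 ^^ (r + 1)) \<Omega>" by (simp only: t1_funpow_vacuum)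
    show "\<Omega> \<in> D" by (rule vacuum_in_D)
    fix i y assume i: "i \<in> set [Suc p..<m + 1]" and y: "y \<in> D"
    then have "n p < n i" using above by auto
    then have "n i - q = (n i - n p) + (r + 1)" "n i - n p \<ge> 1" using r p by linarith+
    then show "(b_dag (n i - n p) ^^ k i) y \<in> D \<and>
        (b_dag (n i - q) ^^ k i) ((t 1 ^^ (r + 1)) y) = (t 1 ^^ (r + 1)) ((b_dag (n i - n p) ^^ k i) y)"
      using y by (simp only: b_dag_funpow_in_D b_dag_funpow_shift simp_thms)
  qed
  have "foldr (\<lambda>i. b_dag (n i - q) ^^ k i) [p..<m + 1] \<Omega>
      = (b_dag (1 + r) ^^ k p) ((t 1 ^^ r) (t 1 ?L))"
    unfolding upt using bose r by (simp add: funpow_swap1)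
  also have "\<dots> = (t 1 ^^ r) (?c *\<^sub>C S (k p) ?L)"
    using bose by (simp only: b_dag_funpow_shift b_dag_1_funpow_t1 t_in_D le_refl)
  also have "\<dots> = (?c * ?C) *\<^sub>C (t 1 ^^ r) (S (k p) ?R)"
    unfolding IH by (simp only: S_scaleC t1_funpow_scaleC scaleC_scaleC)
  finally have lhs: "foldr (\<lambda>i. b_dag (n i - q) ^^ k i) [p..<m + 1] \<Omega>
      = (?c * ?C) *\<^sub>C (t 1 ^^ r) (S (k p) ?R)" .

  have "?R \<in> UNIV \<and> foldr (\<lambda>i. A (n i + (\<Sum>j=p..<i. k j) - 1 - q) (k i)) [Suc p..<m + 1] \<Omega>
      = (t 1 ^^ (r + k p + 1)) ?R"
  proof (rule foldr_intertwine[where D = UNIV])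
    show "\<Omega> = (t 1 ^^ (r + k p + 1)) \<Omega>" by (simp only: t1_funpow_vacuum)
    fix i y assume i: "i \<in> set [Suc p..<m + 1]"
    then have "n p < n i" using above by auto
    moreover have "(\<Sum>j=p..<i. k j) = k p + (\<Sum>j=Suc p..<i. k j)"
      using i by (intro sum.atLeast_Suc_lessThan) auto
    ultimately have "n i + (\<Sum>j=p..<i. k j) - 1 - q
        = (n i + (\<Sum>j=Suc p..<i. k j) - 1 - n p) + (r + k p + 1)"
      using r p by linarith
    then show "A (n i + (\<Sum>j=Suc p..<i. k j) - 1 - n p) (k i) y \<in> UNIV \<and>
        A (n i + (\<Sum>j=p..<i. k j) - 1 - q) (k i) ((t 1 ^^ (r + k p + 1)) y)
          = (t 1 ^^ (r + k p + 1)) (A (n i + (\<Sum>j=Suc p..<i. k j) - 1 - n p) (k i) y)"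
      by (simp only: A_shift UNIV_I simp_thms)
  qed simp
  then have "foldr (\<lambda>i. A (n i + (\<Sum>j=p..<i. k j) - 1 - q) (k i)) [p..<m + 1] \<Omega>
      = A (0 + r) (k p) ((t 1 ^^ r) ((t 1 ^^ k p) (t 1 ?R)))"
    unfolding upt by (simp add: r_def funpow_add funpow_swap1)
  also have "\<dots> = (t 1 ^^ r) (S (k p) ?R)"
    by (simp only: A_shift A_0_t1_funpow) (simp add: s_op_def)
  finally show ?case
    using lhs p(1) by (simp add: prod.atLeast_Suc_atMost real_sqrt_mult del: upt_Suc)
qed

end

section \<open>Particle spaces\<close>

context cuntz_vacuum
begin

definition creation_products :: "(nat \<Rightarrow> 'h \<Rightarrow> 'h) \<Rightarrow> nat \<Rightarrow> 'h set" where
  "creation_products c n = {foldr c js \<Omega> | js. length js = n \<and> set js \<subseteq> {1..}}"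

text \<open>
  An operator that adds one letter 2 to every word, up to linear combination, maps products of
  \<open>n\<close> creation operators into the span of the words with \<open>n\<close> letters 2.
\<close>

lemma creation_products_subset_words:
  assumes "\<And>j. j \<ge> 1 \<Longrightarrow> clinear_on D (c j)"
    and raise: "\<And>j n x. j \<ge> 1 \<Longrightarrow> word n x \<Longrightarrow> c j x \<in> cvec.span {x. word (Suc n) x}"
  shows "creation_products c n \<subseteq> cvec.span {x. word n x}"
proof -
  have "foldr c js \<Omega> \<in> cvec.span {x. word (length js) x}" if "set js \<subseteq> {1..}" for js
    using that
  proof (induction js)
    case Nil
    then show ?case by (auto intro: cvec.span_base word_vacuum)
  next
    case (Cons j js)
    then have "clinear_on D (c j)" using assms(1) by simp
    then have "c j (foldr c js \<Omega>) \<in> cvec.span {x. word (Suc (length js)) x}"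
      by (rule clinear_on_span_into[OF _ subspace_D])
        (use Cons in \<open>auto intro: word_in_D raise\<close>)
    then show ?case by simp
  qed
  then show ?thesis unfolding creation_products_def by auto
qed

text \<open>
  Conversely every word is reached as soon as prepending a block can be done by creation operators.
\<close>

lemma words_subset_creation_products:
  assumes raise: "\<And>k n x. x \<in> creation_products c n \<Longrightarrow>
      S k x \<in> cvec.span (creation_products c (k + n))"
  shows "word n x \<Longrightarrow> x \<in> cvec.span (creation_products c n)"
proof (induction rule: word.induct)
  case word_vacuum
  then show ?case by (auto intro!: cvec.span_base simp: creation_products_def)
next
  case (word_S n x k)
  show ?case
    by (rule clinear_on_span_into[OF S_linear cvec.subspace_UNIV subset_UNIV raise word_S.IH])
qed

lemma span_creation_products_eq_words:
  assumes "\<And>j. j \<ge> 1 \<Longrightarrow> clinear_on D (c j)"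
    and "\<And>j n x. j \<ge> 1 \<Longrightarrow> word n x \<Longrightarrow> c j x \<in> cvec.span {x. word (Suc n) x}"
    and "\<And>k n x. x \<in> creation_products c n \<Longrightarrow> S k x \<in> cvec.span (creation_products c (k + n))"
  shows "cvec.span (creation_products c n) = cvec.span {x. word n x}"
proof (intro equalityI cvec.span_minimal cvec.subspace_span)
  show "creation_products c n \<subseteq> cvec.span {x. word n x}"
    by (rule creation_products_subset_words) (fact assms(1,2))+
  show "{x. word n x} \<subseteq> cvec.span (creation_products c n)"
    using words_subset_creation_products[of c n] assms(3) by blast
qed

lemma S_span_words:
  assumes "x \<in> cvec.span {x. word n x}"
  shows "S k x \<in> cvec.span {x. word (k + n) x}"
  by (rule clinear_on_span_into[OF S_linear cvec.subspace_UNIV subset_UNIV _ assms])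
    (auto intro: cvec.span_base word_S)

lemma t_span_words:
  assumes "x \<in> cvec.span {x. word n x}"
  shows "t 1 x \<in> cvec.span {x. word n x}" "t 2 x \<in> cvec.span {x. word (Suc n) x}"
  by (rule clinear_on_span_into[OF t_linear cvec.subspace_UNIV subset_UNIV _ assms],
      auto intro: cvec.span_base word_t1[simplified] word_t2)+

lemma word_cases_t:
  assumes "word n x"
  obtains x' where "x = t 1 x'" "word n x'"
  | x' n' where "x = t 2 x'" "word n' x'" "n = Suc n'"
proof -
  obtain k n' x' where x: "x = S k x'" "word n' x'" "n = k + n'"
    using assms by (rule word_casesE)
  show ?thesis
  proof (cases k)
    case 0
    then show ?thesis using that(1)[of x'] x by simp
  next
    case (Suc l)
    then show ?thesis using that(2)[of "S l x'" "l + n'"] x word_S[of n' x' l] by (simp add: S_Suc)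
  qed
qed

lemma f_dag_word: "j \<ge> 1 \<Longrightarrow> word n x \<Longrightarrow> f_dag j x \<in> cvec.span {x. word (Suc n) x}"
proof (induction j arbitrary: n x rule: nat_induct_at_least)
  case base
  then show ?case
  proof (cases rule: word_cases_t)
    case (1 x')
    then show ?thesis by (simp only: f_dag_1_t1) (rule cvec.span_base, simp add: word_t2)
  next
    case (2 x' n')
    then show ?thesis by (simp only: f_dag_1_t2 cvec.span_zero)
  qed
next
  case (Suc j)
  from Suc.prems show ?case
  proof (cases rule: word_cases_t)
    case (1 x')
    then show ?thesis using Suc.hyps t_span_words(1)[OF Suc.IH[OF 1(2)]] by (simp only: f_dag_Suc_t1)
  next
    case (2 x' n')
    then show ?thesis
      using Suc.hyps cvec.span_neg[OF t_span_words(2)[OF Suc.IH[OF 2(2)]]] by (simp only: f_dag_Suc_t2)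
  qed
qed

text \<open>
  Prepending \<open>k + 1\<close> letters 1 shifts the indices of the product by \<open>k + 1\<close>; the operators
  \<open>a\<^sub>1\<^sup>* \<dots> a\<^sub>k\<^sup>*\<close> then turn the first \<open>k\<close> of them into 2.
\<close>

lemma S_fermion_products:
  assumes "x \<in> creation_products f_dag n"
  shows "S k x \<in> cvec.span (creation_products f_dag (k + n))"
proof -
  obtain js where js: "x = foldr f_dag js \<Omega>" "length js = n" "set js \<subseteq> {1..}"
    using assms unfolding creation_products_def by auto
  have "S k x = A 0 k ((t 1 ^^ (k + 1)) x)"
    using A_0_t1_funpow[of k "t 1 x"] by (simp add: s_op_def funpow_swap1)
  also have "(t 1 ^^ (k + 1)) x = foldr f_dag (map (\<lambda>j. j + (k + 1)) js) \<Omega>"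
    using foldr_f_dag_shift[of js "k + 1" \<Omega>] js by (auto simp: t1_funpow_vacuum subset_eq simp del: One_nat_def)
  finally have "S k x = foldr f_dag ([1..<k + 1] @ map (\<lambda>j. j + (k + 1)) js) \<Omega>"
    by (simp add: A_op_def)
  then show ?thesis
    unfolding creation_products_def using js
    by (intro cvec.span_base CollectI exI[of _ "[1..<k + 1] @ map (\<lambda>j. j + (k + 1)) js"]) auto
qed

lemma span_fermion_products: "cvec.span (creation_products f_dag n) = cvec.span {x. word n x}"
proof (rule span_creation_products_eq_words)
  show "clinear_on D (f_dag j)" if "j \<ge> 1" for j
    using f_dag_linear[OF that] unfolding clinear_on_def by blast
qed (rule f_dag_word S_fermion_products, assumption+)+

end

context rbs_representation
begin

lemma b_dag_word: "j \<ge> 1 \<Longrightarrow> word n x \<Longrightarrow> b_dag j x \<in> cvec.span {x. word (Suc n) x}"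
proof (induction j arbitrary: n x rule: nat_induct_at_least)
  case base
  then obtain k n' x' where "x = S k x'" "word n' x'" "n = k + n'" by (rule word_casesE)
  then show ?case
    using word_S[of n' x' "Suc k"]
    by (simp only: b_dag_1_S word_in_D) (rule cvec.span_scale, rule cvec.span_base, simp)
next
  case (Suc j)
  obtain k n' x' where x: "x = S k x'" "word n' x'" "n = k + n'"
    using Suc.prems by (rule word_casesE)
  then show ?case
    using Suc.hyps S_span_words[OF Suc.IH[OF x(2)], of k] by (simp add: b_dag_Suc_S word_in_D)
qed

text \<open>
  Prepending a letter 1 opens a new first mode, which shifts the indices by one, and \<open>(b\<^sub>1\<^sup>*)\<^sup>k\<close> fills
  it with \<open>k\<close> particles, up to the nonzero factor \<open>sqrt (k!)\<close>.
\<close>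

lemma S_boson_products:
  assumes "x \<in> creation_products b_dag n"
  shows "S k x \<in> cvec.span (creation_products b_dag (k + n))"
proof -
  obtain js where js: "x = foldr b_dag js \<Omega>" "length js = n" "set js \<subseteq> {1..}"
    using assms unfolding creation_products_def by auto
  have shift: "foldr b_dag js \<Omega> \<in> D \<and> foldr (\<lambda>j. b_dag (j + 1)) js \<Omega> = (t 1 ^^ 1) (foldr b_dag js \<Omega>)"
    by (rule foldr_intertwine)
      (use js b_dag_in_D b_dag_shift[where r = 1] vacuum_in_D t1_funpow_vacuum[of 1] in \<open>auto simp: subset_eq\<close>)
  let ?js = "replicate k 1 @ map (\<lambda>j. j + 1) js"
  have "complex_of_real (sqrt (fact k)) *\<^sub>C S k x = (b_dag 1 ^^ k) (t 1 x)"
    using shift by (simp add: b_dag_1_funpow_t1 js del: One_nat_def)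
  also have "\<dots> = foldr b_dag ?js \<Omega>"
    using shift js(1) by (simp add: foldr_map comp_def foldr_replicate)
  also have "\<dots> \<in> creation_products b_dag (k + n)"
    unfolding creation_products_def using js by (intro CollectI exI[of _ ?js]) auto
  finally have "(1 / complex_of_real (sqrt (fact k))) *\<^sub>C complex_of_real (sqrt (fact k)) *\<^sub>C S k x
      \<in> cvec.span (creation_products b_dag (k + n))"
    by (intro cvec.span_scale cvec.span_base)
  then show ?thesis by (simp add: scaleC_scaleC)
qed

lemma span_boson_products: "cvec.span (creation_products b_dag n) = cvec.span {x. word n x}"
  by (rule span_creation_products_eq_words)
    (rule b_dag_linear b_dag_word S_boson_products, assumption+)+

end

section \<open>Transport to the Fock spaces\<close>

text \<open>
  On \<open>D\<close> the intertwining relation reads \<open>rbs t n = V\<^sup>* b\<^sub>n V\<close>, so linearity and the existence of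
  adjoints are inherited from the operators \<open>b\<^sub>n\<close>.
\<close>

lemma rbs_representation_of_intertwiner:
  assumes "cuntz_vacuum_rep t \<Omega>" "bose_fock D\<^sub>B b \<Omega>\<^sub>B" and int: "bose_intertwiner t \<Omega> D\<^sub>B b \<Omega>\<^sub>B V"
  shows "rbs_representation t \<Omega>"
proof -
  interpret cuntz_vacuum t \<Omega> by standard fact
  have V: "unitary V" and image: "V ` D = D\<^sub>B"
    using int unfolding bose_intertwiner_def by auto
  have b: "clinear_on D\<^sub>B (b n)" "has_adj_on D\<^sub>B (b n)" if "n \<ge> 1" for n
    using assms(2) that unfolding bose_fock_def boson_rep_def star_ops_def has_adj_on_def by auto
  have V_rbs: "V (rbs t n x) = b n (V x)" if "n \<ge> 1" "x \<in> D" for n x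
  proof -
    have "V x \<in> D\<^sub>B" using image that by auto
    then have "V (rbs t n (adj V (V x))) = b n (V x)"
      using int that unfolding bose_intertwiner_def by blast
    then show ?thesis by (simp add: unitary_adj_apply[OF V])
  qed
  then have rbs: "rbs t n x = adj V (b n (V x))" if "n \<ge> 1" "x \<in> D" for n x
    using that unitary_adj_apply[OF V, of "rbs t n x"] by simp
  show ?thesis
  proof
    fix n :: nat assume n: "n \<ge> 1"
    have inD: "V x \<in> D\<^sub>B" if "x \<in> D" for x using that image by auto
    show "clinear_on D (rbs t n)"
      using b(1)[OF n] inD subspace_D n unfolding clinear_on_def
      by (auto simp: rbs cvec.subspace_add cvec.subspace_scale unitary_linear V unitary_adj)
    show "has_adj_on D (rbs t n)"
      unfolding has_adj_on_def
    proof
      fix y assume "y \<in> D"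
      then obtain z where z: "z \<in> D" "\<forall>x\<in>D\<^sub>B. cinner (V z) x = cinner (V y) (b n x)"
        using b(2)[OF n] inD image unfolding has_adj_on_def by blast
      have "cinner z x = cinner y (rbs t n x)" if "x \<in> D" for x
        using z(2) inD[OF that] by (metis V V_rbs n that unitary_cinner)
      then show "\<exists>z\<in>D. \<forall>x\<in>D. cinner z x = cinner y (rbs t n x)"
        using z(1) by blast
    qed
  qed
qed

context cuntz_vacuum
begin

text \<open>
  Stated for a general family \<open>c\<close> in order to cover both Fock spaces; the right-hand side depends on
  the Fock space only through the unitary, so two such images correspond under \<open>V\<^sub>F V\<^sub>B\<^sup>*\<close>.
\<close>

lemma particle_space_eq_image:
  assumes V: "unitary V" "V \<Omega> = \<Psi>" and c_in: "\<And>j x. j \<ge> 1 \<Longrightarrow> x \<in> E \<Longrightarrow> c j x \<in> E"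
    and c: "\<And>j x. j \<ge> 1 \<Longrightarrow> x \<in> E \<Longrightarrow> adj_on D' (g j) (V x) = V (c j x)"
    and "\<Omega> \<in> E" and words: "cvec.span (creation_products c n) = cvec.span {x. word n x}"
  shows "particle_space D' g \<Psi> n = V ` (if n = 0 then cvec.span {\<Omega>} else closure (cvec.span {x. word n x}))"
proof -
  have "foldr (\<lambda>j. adj_on D' (g j)) js \<Psi> = V (foldr c js \<Omega>)" if "set js \<subseteq> {1..}" for js
    using foldr_intertwine[of \<Psi> V \<Omega> E js c "\<lambda>j. adj_on D' (g j)"] that assms by (auto simp: subset_eq)
  then have "{foldr (\<lambda>j. adj_on D' (g j)) js \<Psi> | js. length js = n \<and> set js \<subseteq> {1..}}
      = V ` creation_products c n"
    unfolding creation_products_def by (auto simp: image_iff) metis+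
  then show ?thesis
    by (simp add: particle_space_def unitary_image_closure unitary_image_span V flip: words)
qed

end

theorem theorem1p3:
  fixes t :: "nat \<Rightarrow> 'h \<Rightarrow> 'h::complex_hilbert" and \<Omega> :: 'h
    and D\<^sub>B :: "'b::complex_hilbert set" and b :: "nat \<Rightarrow> 'b \<Rightarrow> 'b" and \<Omega>\<^sub>B :: 'b
    and a :: "nat \<Rightarrow> 'f \<Rightarrow> 'f::complex_hilbert" and \<Omega>\<^sub>F :: 'f
    and V\<^sub>B :: "'h \<Rightarrow> 'b" and V\<^sub>F :: "'h \<Rightarrow> 'f" and U :: "'b \<Rightarrow> 'f"
  assumes "cuntz_vacuum_rep t \<Omega>"
    and "bose_fock D\<^sub>B b \<Omega>\<^sub>B"
    and "fermi_fock a \<Omega>\<^sub>F"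
    and "bose_intertwiner t \<Omega> D\<^sub>B b \<Omega>\<^sub>B V\<^sub>B"
    and "fermi_intertwiner t \<Omega> a \<Omega>\<^sub>F V\<^sub>F"
    and "U = V\<^sub>F \<circ> adj V\<^sub>B"
  shows "U \<Omega>\<^sub>B = \<Omega>\<^sub>F \<and>
    (\<forall>(m::nat) (n::nat \<Rightarrow> nat) (k::nat \<Rightarrow> nat).
       m \<ge> 1 \<longrightarrow> strict_mono_on {1..m} n \<longrightarrow> (\<forall>i\<in>{1..m}. n i \<ge> 1 \<and> k i \<ge> 1) \<longrightarrow>
       U (foldr (\<lambda>i. adj_on D\<^sub>B (b (n i)) ^^ k i) [1..<m + 1] \<Omega>\<^sub>B) =
       complex_of_real (sqrt (\<Prod>i=1..m. fact (k i))) *\<^sub>C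
         foldr (\<lambda>i. A_op a (n i + (\<Sum>j=1..<i. k j) - 1) (k i)) [1..<m + 1] \<Omega>\<^sub>F) \<and>
    (\<forall>n::nat. U ` particle_space D\<^sub>B b \<Omega>\<^sub>B n = particle_space UNIV a \<Omega>\<^sub>F n)"
proof -
  interpret rbs_representation t \<Omega>
    by (rule rbs_representation_of_intertwiner) fact+
  have VB: "unitary V\<^sub>B" "V\<^sub>B \<Omega> = \<Omega>\<^sub>B" "V\<^sub>B ` D = D\<^sub>B" and VF: "unitary V\<^sub>F" "V\<^sub>F \<Omega> = \<Omega>\<^sub>F"
    using assms(4,5) unfolding bose_intertwiner_def fermi_intertwiner_def by auto
  have U_VB: "U (V\<^sub>B x) = V\<^sub>F x" for x
    by (simp add: assms(6) unitary_adj_apply[OF VB(1)])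
  have bose: "adj_on D\<^sub>B (b n) (V\<^sub>B x) = V\<^sub>B (b_dag n x)" if "n \<ge> 1" "x \<in> D" for n x
  proof -
    have "V\<^sub>B x \<in> D\<^sub>B" using VB(3) that by blast
    then have "V\<^sub>B (b_dag n (adj V\<^sub>B (V\<^sub>B x))) = adj_on D\<^sub>B (b n) (V\<^sub>B x)"
      using assms(4) that unfolding bose_intertwiner_def by blast
    then show ?thesis by (simp add: unitary_adj_apply[OF VB(1)])
  qed
  have fermi: "adj (a n) (V\<^sub>F x) = V\<^sub>F (f_dag n x)" if "n \<ge> 1" for n x
  proof -
    have "V\<^sub>F (f_dag n (adj V\<^sub>F (V\<^sub>F x))) = adj (a n) (V\<^sub>F x)"
      using assms(5) that unfolding fermi_intertwiner_def by blast
    then show ?thesis by (simp add: unitary_adj_apply[OF VF(1)])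
  qed
  have A_VF: "A_op a n k (V\<^sub>F x) = V\<^sub>F (A n k x)" for n k x
    using foldr_intertwine[of "V\<^sub>F x" V\<^sub>F x UNIV "[n + 1..<n + k + 1]" f_dag "\<lambda>j. adj (a j)"] fermi
    by (simp add: A_op_def del: upt_Suc)

  have "U (foldr (\<lambda>i. adj_on D\<^sub>B (b (n i)) ^^ k i) [1..<m + 1] \<Omega>\<^sub>B) =
       complex_of_real (sqrt (\<Prod>i=1..m. fact (k i))) *\<^sub>C
         foldr (\<lambda>i. A_op a (n i + (\<Sum>j=1..<i. k j) - 1) (k i)) [1..<m + 1] \<Omega>\<^sub>F"
    if n: "strict_mono_on {1..m} n" "\<forall>i\<in>{1..m}. n i \<ge> 1 \<and> k i \<ge> 1"
    for m :: nat and n k :: "nat \<Rightarrow> nat"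
  proof -
    have "foldr (\<lambda>i. adj_on D\<^sub>B (b (n i)) ^^ k i) [1..<m + 1] \<Omega>\<^sub>B
        = V\<^sub>B (foldr (\<lambda>i. b_dag (n i) ^^ k i) [1..<m + 1] \<Omega>)"
    proof (rule foldr_intertwine[THEN conjunct2])
      fix i y assume "i \<in> set [1..<m + 1]" "y \<in> D"
      then show "(b_dag (n i) ^^ k i) y \<in> D \<and>
          (adj_on D\<^sub>B (b (n i)) ^^ k i) (V\<^sub>B y) = V\<^sub>B ((b_dag (n i) ^^ k i) y)"
        using n(2) by (intro funpow_intertwine) (auto simp: bose b_dag_in_D)
    qed (use VB vacuum_in_D in auto)
    then have "U (foldr (\<lambda>i. adj_on D\<^sub>B (b (n i)) ^^ k i) [1..<m + 1] \<Omega>\<^sub>B)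
        = V\<^sub>F (foldr (\<lambda>i. b_dag (n i) ^^ k i) [1..<m + 1] \<Omega>)"
      by (simp only: U_VB)
    also have "foldr (\<lambda>i. b_dag (n i) ^^ k i) [1..<m + 1] \<Omega> =
        complex_of_real (sqrt (\<Prod>i=1..m. fact (k i))) *\<^sub>C
          foldr (\<lambda>i. A (n i + (\<Sum>j=1..<i. k j) - 1) (k i)) [1..<m + 1] \<Omega>"
      using ordered_product[OF n(1), of 1 0 k] n(2) by (simp add: Suc_le_eq)
    finally have "U (foldr (\<lambda>i. adj_on D\<^sub>B (b (n i)) ^^ k i) [1..<m + 1] \<Omega>\<^sub>B) =
        complex_of_real (sqrt (\<Prod>i=1..m. fact (k i))) *\<^sub>C
          V\<^sub>F (foldr (\<lambda>i. A (n i + (\<Sum>j=1..<i. k j) - 1) (k i)) [1..<m + 1] \<Omega>)"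
      by (simp only: unitary_linear[OF VF(1)])
    also have "V\<^sub>F (foldr (\<lambda>i. A (n i + (\<Sum>j=1..<i. k j) - 1) (k i)) [1..<m + 1] \<Omega>)
        = foldr (\<lambda>i. A_op a (n i + (\<Sum>j=1..<i. k j) - 1) (k i)) [1..<m + 1] \<Omega>\<^sub>F"
      by (rule foldr_intertwine[where D = UNIV, THEN conjunct2, symmetric]) (simp_all add: VF A_VF)
    finally show ?thesis .
  qed
  moreover have "U ` particle_space D\<^sub>B b \<Omega>\<^sub>B n = particle_space UNIV a \<Omega>\<^sub>F n" for n
  proof -
    note particle_space_eq_image[OF VB(1,2) b_dag_in_D bose vacuum_in_D span_boson_products]
    moreover have "particle_space UNIV a \<Omega>\<^sub>F n
        = V\<^sub>F ` (if n = 0 then cvec.span {\<Omega>} else closure (cvec.span {x. word n x}))"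
      by (rule particle_space_eq_image[OF VF _ fermi UNIV_I span_fermion_products]) auto
    ultimately show ?thesis by (simp only: image_image U_VB)
  qed
  moreover have "U \<Omega>\<^sub>B = \<Omega>\<^sub>F"
    using U_VB[of \<Omega>] VB VF by simp
  ultimately show ?thesis by blast
qed

end
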